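(* Let $u_{ij}=x_iy_j$ for $1\le i,j\le4$ and let $$T=\sum_{i=1}^{4}u_{ii}^2+(u_{12}+u_{34})^2+(u_{13}+u_{42})^2+(u_{14}+u_{23})^2+(u_{21}+u_{43})^2+(u_{24}+u_{31})^2+(u_{32}+u_{41})^2.$$ Then $T$ can be represented as a sum of nine squares of real bilinear forms in $(x_1,\dots,x_4)$ and $(y_1,\dots,y_4)$. Hence the displayed ten-square decomposition of $T$ is reducible, i.e. it is not a sum-of-squares representation of $T$ of minimum length.
   Context: A bilinear form is a real linear combination of the monomials $u_{ij}=x_iy_j$, where $x_1,\dots,x_4,y_1,\dots,y_4$ are real variables; equality of polynomials is meant in $\mathbb R[x_1,\dots,x_4,y_1,\dots,y_4]$. *)

theory Defs
  imports Complex_Main "HOL-Library.Poly_Mapping" "HOL-Library.Numeral_Type"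
begin

(* Indices range over the four-element type 4. Its numerals are read modulo 4,
   so 4 = 0 there, and 1, 2, 3, 4 are its four distinct elements. *)
datatype var = X 4 | Y 4

(* The polynomial ring R[x_1,...,x_4,y_1,...,y_4]: finitely supported maps from
   exponent vectors to real coefficients, with convolution as multiplication. *)
type_synonym mpoly = "(var \<Rightarrow>\<^sub>0 nat) \<Rightarrow>\<^sub>0 real"

definition indet :: "var \<Rightarrow> mpoly" where
  "indet v = Poly_Mapping.single (Poly_Mapping.single v 1) 1"

definition const :: "real \<Rightarrow> mpoly" where
  "const c = Poly_Mapping.single 0 c"

definition u :: "4 \<Rightarrow> 4 \<Rightarrow> mpoly" where
  "u i j = indet (X i) * indet (Y j)"

definition bilinear_form :: "mpoly \<Rightarrow> bool" where
  "bilinear_form f \<longleftrightarrow>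
     (\<exists>c :: 4 \<Rightarrow> 4 \<Rightarrow> real. f = (\<Sum>i\<in>UNIV. \<Sum>j\<in>UNIV. const (c i j) * u i j))"

definition sos_representation :: "mpoly \<Rightarrow> mpoly list \<Rightarrow> bool" where
  "sos_representation p fs \<longleftrightarrow> p = (\<Sum>f\<leftarrow>fs. f\<^sup>2)"

(* The competing representations may use arbitrary polynomials, not only
   bilinear forms, and repetitions are counted. *)
definition minimum_length_representation :: "mpoly \<Rightarrow> mpoly list \<Rightarrow> bool" where
  "minimum_length_representation p fs \<longleftrightarrow>
     sos_representation p fs \<and>
     (\<forall>gs. sos_representation p gs \<longrightarrow> length fs \<le> length gs)"

definition reducible_representation :: "mpoly \<Rightarrow> mpoly list \<Rightarrow> bool" where
  "reducible_representation p fs \<longleftrightarrow>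
     sos_representation p fs \<and> \<not> minimum_length_representation p fs"

definition T :: mpoly where
  "T = (\<Sum>i\<in>UNIV. (u i i)\<^sup>2)
     + (u 1 2 + u 3 4)\<^sup>2 + (u 1 3 + u 4 2)\<^sup>2 + (u 1 4 + u 2 3)\<^sup>2
     + (u 2 1 + u 4 3)\<^sup>2 + (u 2 4 + u 3 1)\<^sup>2 + (u 3 2 + u 4 1)\<^sup>2"

definition ten_forms :: "mpoly list" where
  "ten_forms =
     [u 1 1, u 2 2, u 3 3, u 4 4,
      u 1 2 + u 3 4, u 1 3 + u 4 2, u 1 4 + u 2 3,
      u 2 1 + u 4 3, u 2 4 + u 3 1, u 3 2 + u 4 1]"

end

theory Submission
  imports Defs
begin

text \<open>
  The monomial \<open>x\<^sub>i x\<^sub>k y\<^sub>j y\<^sub>l\<close> is both \<open>u\<^sub>i\<^sub>j u\<^sub>k\<^sub>l\<close> and \<open>u\<^sub>i\<^sub>l u\<^sub>k\<^sub>j\<close>, so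
  the Gram matrix of \<open>T\<close> may be modified. Look for one invariant under the sign changes
  \<open>x\<^sub>i \<mapsto> \<epsilon>\<^sub>i x\<^sub>i\<close>, \<open>y\<^sub>i \<mapsto> \<epsilon>\<^sub>i y\<^sub>i\<close> with \<open>\<epsilon>\<^sub>1 \<epsilon>\<^sub>2 \<epsilon>\<^sub>3 \<epsilon>\<^sub>4 = 1\<close> and under the rotation \<open>2 \<rightarrow> 3 \<rightarrow> 4 \<rightarrow> 2\<close>.
  It splits into a block on the \<open>u\<^sub>i\<^sub>i\<close> and three equal blocks, the first of them on
  \<open>u\<^sub>1\<^sub>2, u\<^sub>2\<^sub>1, u\<^sub>3\<^sub>4, u\<^sub>4\<^sub>3\<close>. With \<open>a\<close> and \<open>b\<close> the coefficients of \<open>2 u\<^sub>1\<^sub>1 u\<^sub>i\<^sub>i\<close> and \<open>2 u\<^sub>i\<^sub>i u\<^sub>j\<^sub>j\<close>,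
  and \<open>p\<close>, \<open>1 - p\<close> those of \<open>2 u\<^sub>1\<^sub>2 u\<^sub>3\<^sub>4\<close> and \<open>2 u\<^sub>1\<^sub>2 u\<^sub>4\<^sub>3\<close>, the equal blocks have rank 2 iff
  \<open>2 (1 - a) p (1 - p) = a\<^sup>2\<close> and \<open>b (1 - a) = - a\<close>, and the diagonal block has rank 3 if
  \<open>1 + 2 b = 3 a\<^sup>2\<close>. Eliminating \<open>b\<close> leaves the cubic \<open>3 a\<^sup>3 - 3 a\<^sup>2 - 3 a + 1 = 0\<close>, which has a
  root in \<open>[0, 1/3]\<close>. The total rank is \<open>3 + 2 + 2 + 2 = 9\<close>.
\<close>

lemma const_add: "const (c + d) = const c + const d"
  by (simp add: const_def single_add)

lemma const_mult: "const (c * d) = const c * const d"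
  by (simp add: const_def mult_single)

lemma const_uminus: "const (- c) = - const c"
  by (simp add: const_def single_uminus)

lemma const_diff: "const (c - d) = const c - const d"
  by (simp add: const_def single_diff)

lemma const_0: "const 0 = 0"
  by (simp add: const_def)

lemma const_1: "const 1 = 1"
  by (simp add: const_def)

lemmas const_hom = const_add const_mult const_uminus const_diff const_0 const_1

lemma sum_four: "(\<Sum>i\<in>UNIV. f i) = f (1::4) + f 2 + f 3 + f 4"
  for f :: "4 \<Rightarrow> 'a::comm_monoid_add"
proof -
  have "(UNIV :: 4 set) = {1, 2, 3, 4}"
    by (rule card_seteq[symmetric]) simp_all
  then have "(\<Sum>i\<in>UNIV. f i) = sum f {1, 2, 3, 4}" by (rule arg_cong)
  also have "\<dots> = f 1 + f 2 + f 3 + f 4" by (simp add: add.assoc)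
  finally show ?thesis .
qed

lemma bilinear_form_u: "bilinear_form (u i j)"
  unfolding bilinear_form_def
proof
  have "(\<Sum>l\<in>UNIV. const (if k = i \<and> l = j then 1 else 0) * u k l) = (if k = i then u k j else 0)" for k
    by (cases "k = i") (simp_all add: const_0 const_1 if_distrib[of const] if_distrib[of "\<lambda>c. c * _"] cong: if_cong)
  then show "u i j = (\<Sum>k\<in>UNIV. \<Sum>l\<in>UNIV. const (if k = i \<and> l = j then 1 else 0) * u k l)"
    by simp
qed

lemma bilinear_form_add: "bilinear_form f \<Longrightarrow> bilinear_form g \<Longrightarrow> bilinear_form (f + g)"
  unfolding bilinear_form_def
proof (elim exE)
  fix c d
  assume "f = (\<Sum>i\<in>UNIV. \<Sum>j\<in>UNIV. const (c i j) * u i j)"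
    and "g = (\<Sum>i\<in>UNIV. \<Sum>j\<in>UNIV. const (d i j) * u i j)"
  then show "\<exists>e. f + g = (\<Sum>i\<in>UNIV. \<Sum>j\<in>UNIV. const (e i j) * u i j)"
    by (intro exI[of _ "\<lambda>i j. c i j + d i j"]) (simp add: const_add ring_distribs sum.distrib)
qed

lemma bilinear_form_const_mult: "bilinear_form f \<Longrightarrow> bilinear_form (const c * f)"
  unfolding bilinear_form_def
proof (elim exE)
  fix d
  assume "f = (\<Sum>i\<in>UNIV. \<Sum>j\<in>UNIV. const (d i j) * u i j)"
  then show "\<exists>e. const c * f = (\<Sum>i\<in>UNIV. \<Sum>j\<in>UNIV. const (e i j) * u i j)"
    by (intro exI[of _ "\<lambda>i j. c * d i j"]) (simp add: const_mult sum_distrib_left mult.assoc)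
qed

lemma parameters_exist:
  obtains a b p :: real
  where "0 \<le> a" "a \<le> 1/3" "1 + 2 * b = 3 * a\<^sup>2" "b * (1 - a) = - a" "2 * (1 - a) * (p * (1 - p)) = a\<^sup>2"
proof -
  let ?f = "\<lambda>x::real. 3 * x^3 - 3 * x\<^sup>2 - 3 * x + 1"
  have "\<exists>x\<ge>0. x \<le> 1/3 \<and> ?f x = 0"
    \<comment> \<open>The cubic is 1 at 0 and -2/9 at 1/3.\<close>
    by (rule IVT2') (auto intro!: continuous_intros simp: power2_eq_square power3_eq_cube)
  then obtain a where a: "0 \<le> a" "a \<le> 1/3" "?f a = 0" by blast
  define t where "t = a\<^sup>2 / (2 * (1 - a))"
  \<comment> \<open>A root of \<open>x\<^sup>2 - x + t\<close>, real because
    \<open>a \<le> 1/3\<close> keeps \<open>4 * t\<close> below 1.\<close>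
  define p where "p = (1 + sqrt (1 - 4 * t)) / 2"
  have "a * a \<le> 1/3 * (1/3)" using a by (intro mult_mono) auto
  then have "4 * t \<le> 1" using a by (simp add: t_def power2_eq_square divide_simps)
  then have "(sqrt (1 - 4 * t))\<^sup>2 = 1 - 4 * t" by simp
  then have "p * (1 - p) = t" by (simp add: p_def field_simps power2_eq_square)
  then have "2 * (1 - a) * (p * (1 - p)) = a\<^sup>2" using a by (simp add: t_def)
  moreover have "1 + 2 * (- a / (1 - a)) = 3 * a\<^sup>2"
    using a by (simp add: field_simps power2_eq_square power3_eq_cube)
  moreover have "- a / (1 - a) * (1 - a) = - a" using a by simp
  ultimately show thesis using that a by blast
qed

text \<open>The columns (1,0,0), (a,s,0), (a,-m,n), (a,-m,-n) factor the Gram matrix: the hypotheses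
  make the last three unit vectors with pairwise products \<open>b\<close>.\<close>

lemma diagonal_block:
  fixes A B C D a b s m n :: "'a :: comm_ring_1"
  assumes "a * a + s * s = 1" "a * a + m * m + n * n = 1" "a * a - s * m = b" "a * a + m * m - n * n = b"
  shows "(A + a * B + a * C + a * D)\<^sup>2 + (s * B + (- m) * C + (- m) * D)\<^sup>2 + (n * C + (- n) * D)\<^sup>2
    = A\<^sup>2 + B\<^sup>2 + C\<^sup>2 + D\<^sup>2 + 2 * a * (A * B + A * C + A * D) + 2 * b * (B * C + B * D + C * D)"
    (is "?lhs = ?rhs")
proof -
  have "?lhs = A\<^sup>2 + (a * a + s * s) * B\<^sup>2 + (a * a + m * m + n * n) * (C\<^sup>2 + D\<^sup>2)
      + 2 * a * (A * B + A * C + A * D) + 2 * (a * a - s * m) * (B * C + B * D)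
      + 2 * (a * a + m * m - n * n) * (C * D)"
    by (simp add: algebra_simps power2_eq_square)
  also have "\<dots> = ?rhs"
    unfolding assms by (simp add: algebra_simps)
  finally show ?thesis .
qed

text \<open>Rank 2 factorization by the plane vectors (1,0), (-a,s), (p,g), (q,h); the hypotheses
  give their remaining lengths and inner products.\<close>

lemma off_diagonal_block:
  fixes A B C D a b p q s g h :: "'a :: comm_ring_1"
  assumes "a * a + s * s = 1" "p * p + g * g = 1" "q * q + h * h = 1"
    "s * g - a * p = q" "s * h - a * q = p" "p * q + g * h = - b"
  shows "(A + (- a) * B + p * C + q * D)\<^sup>2 + (s * B + g * C + h * D)\<^sup>2
    = A\<^sup>2 + B\<^sup>2 + C\<^sup>2 + D\<^sup>2 - 2 * a * (A * B) - 2 * b * (C * D)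
      + 2 * p * (A * C + B * D) + 2 * q * (A * D + B * C)"
    (is "?lhs = ?rhs")
proof -
  have "?lhs = A\<^sup>2 + (a * a + s * s) * B\<^sup>2 + (p * p + g * g) * C\<^sup>2 + (q * q + h * h) * D\<^sup>2
      - 2 * a * (A * B) + 2 * p * (A * C) + 2 * q * (A * D) + 2 * (s * g - a * p) * (B * C)
      + 2 * (s * h - a * q) * (B * D) + 2 * (p * q + g * h) * (C * D)"
    by (simp add: algebra_simps power2_eq_square)
  also have "\<dots> = ?rhs"
    unfolding assms by (simp add: algebra_simps)
  finally show ?thesis .
qed

text \<open>The \<open>a\<close> and \<open>b\<close> terms of the diagonal block cancel against the
  other three, and each \<open>k\<close> occurs in two blocks, with weights \<open>p\<close> and
  \<open>q\<close>.\<close>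

lemma blocks_sum:
  fixes a b p q :: "'a :: comm_ring_1"
  assumes "p + q = 1"
  shows "(d + 2 * a * (x1 + x2 + x3) + 2 * b * (y1 + y2 + y3))
    + (e1 - 2 * a * x1 - 2 * b * y3 + 2 * p * (k1 + k2) + 2 * q * (k3 + k4))
    + (e2 - 2 * a * x2 - 2 * b * y2 + 2 * p * (k3 + k4) + 2 * q * (k5 + k6))
    + (e3 - 2 * a * x3 - 2 * b * y1 + 2 * p * (k5 + k6) + 2 * q * (k1 + k2))
    = d + e1 + e2 + e3 + 2 * (k1 + k2 + k3 + k4 + k5 + k6)"
proof -
  have q: "q = 1 - p" using assms by (metis add_diff_cancel_left')
  show ?thesis unfolding q by (simp add: algebra_simps)
qed

lemma T_expand:
  "T = ((u 1 1)\<^sup>2 + (u 2 2)\<^sup>2 + (u 3 3)\<^sup>2 + (u 4 4)\<^sup>2)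
    + ((u 1 2)\<^sup>2 + (u 2 1)\<^sup>2 + (u 3 4)\<^sup>2 + (u 4 3)\<^sup>2)
    + ((u 1 3)\<^sup>2 + (u 3 1)\<^sup>2 + (u 4 2)\<^sup>2 + (u 2 4)\<^sup>2)
    + ((u 1 4)\<^sup>2 + (u 4 1)\<^sup>2 + (u 2 3)\<^sup>2 + (u 3 2)\<^sup>2)
    + 2 * (u 1 2 * u 3 4 + u 2 1 * u 4 3 + u 1 3 * u 4 2 + u 3 1 * u 2 4 + u 1 4 * u 2 3 + u 4 1 * u 3 2)"
  unfolding T_def sum_four power2_sum by (simp only: distrib_left add_ac mult_ac)

lemma T_nine_squares:
  "\<exists>fs. length fs = 9 \<and> (\<forall>f\<in>set fs. bilinear_form f) \<and> sos_representation T fs"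
proof -
  obtain a b p :: real where a: "0 \<le> a" "a \<le> 1/3" and b: "1 + 2 * b = 3 * a\<^sup>2"
    and ab: "b * (1 - a) = - a" and ap: "2 * (1 - a) * (p * (1 - p)) = a\<^sup>2"
    by (rule parameters_exist)
  define q s where "q = 1 - p" and "s = sqrt (1 - a\<^sup>2)"
  \<comment> \<open>(s,0), (-m,n), (-m,-n) form an equilateral triangle centred at 0;
    \<open>g\<close> and \<open>h\<close> solve the linear conditions \<open>off4\<close> and
    \<open>off5\<close>.\<close>
  define m n g h where "m = s / 2" and "n = sqrt 3 * s / 2"
    and "g = (q + a * p) / s" and "h = (p + a * q) / s"
  have "a * a \<le> 1/3 * (1/3)" using a by (intro mult_mono) auto
  then have "a\<^sup>2 < 1" by (simp add: power2_eq_square)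
  then have s0: "s \<noteq> 0" and ss: "s * s = 1 - a * a"
    by (simp_all add: s_def power2_eq_square abs_square_eq_1)
  have n2: "n * n = 3 * (s * s) / 4" by (simp add: n_def)
  have diag: "a * a + s * s = 1" "a * a + m * m + n * n = 1" "a * a - s * m = b" "a * a + m * m - n * n = b"
    unfolding n2 using b ss by (simp_all add: m_def power2_eq_square field_simps)
  have pq: "p + q = 1" and apq: "2 * (1 - a) * (p * q) = a * a"
    using ap by (simp_all add: q_def power2_eq_square)
  have gg: "g * g = (q + a * p)\<^sup>2 / (s * s)" and hh: "h * h = (p + a * q)\<^sup>2 / (s * s)"
    and gh: "g * h = (q + a * p) * (p + a * q) / (s * s)"
    by (simp_all add: g_def h_def power2_eq_square)
  have ss0: "s * s \<noteq> 0" using s0 by simp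
  \<comment> \<open>Given \<open>pq\<close>, this identity and its mirror image with
    \<open>p\<close> and \<open>q\<close> exchanged both amount to \<open>apq\<close>.\<close>
  have "(q + a * p)\<^sup>2 = (1 - p * p) * (s * s)" unfolding ss using pq apq by algebra
  then have off2: "p * p + g * g = 1" unfolding gg using ss0 by simp
  have "(p + a * q)\<^sup>2 = (1 - q * q) * (s * s)" unfolding ss using pq apq by algebra
  then have off3: "q * q + h * h = 1" unfolding hh using ss0 by simp
  \<comment> \<open>The factor \<open>1 - a\<close> lets \<open>ab\<close> eliminate
    \<open>b\<close>; it is nonzero as \<open>a \<le> 1/3\<close>.\<close>
  have "(1 - a) * ((q + a * p) * (p + a * q)) = (1 - a) * ((- b - p * q) * (s * s))"
    unfolding ss using pq apq ab by algebra
  then have "(q + a * p) * (p + a * q) = (- b - p * q) * (s * s)" using a by simp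
  then have off6: "p * q + g * h = - b" unfolding gh using ss0 by simp
  have off4: "s * g - a * p = q" and off5: "s * h - a * q = p"
    using s0 by (simp_all add: g_def h_def)
  \<comment> \<open>As \<open>const\<close> is a ring homomorphism, the real identities carry over
    to the polynomial coefficients.\<close>
  note diag' = diag[THEN arg_cong[of _ _ const], unfolded const_hom]
  note off' = diag'(1) off2[THEN arg_cong[of _ _ const], unfolded const_hom]
    off3[THEN arg_cong[of _ _ const], unfolded const_hom]
    off4[THEN arg_cong[of _ _ const], unfolded const_hom]
    off5[THEN arg_cong[of _ _ const], unfolded const_hom]
    off6[THEN arg_cong[of _ _ const], unfolded const_hom]
  note pq' = pq[THEN arg_cong[of _ _ const], unfolded const_hom]
  let ?e = "\<lambda>A B C D. A + const (- a) * B + const p * C + const q * D"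
  let ?f = "\<lambda>B C D. const s * B + const g * C + const h * D"
  let ?fs = "[u 1 1 + const a * u 2 2 + const a * u 3 3 + const a * u 4 4,
    const s * u 2 2 + const (- m) * u 3 3 + const (- m) * u 4 4,
    const n * u 3 3 + const (- n) * u 4 4,
    ?e (u 1 2) (u 2 1) (u 3 4) (u 4 3), ?f (u 2 1) (u 3 4) (u 4 3),
    ?e (u 1 3) (u 3 1) (u 4 2) (u 2 4), ?f (u 3 1) (u 4 2) (u 2 4),
    ?e (u 1 4) (u 4 1) (u 2 3) (u 3 2), ?f (u 4 1) (u 2 3) (u 3 2)]"
  have "\<forall>f\<in>set ?fs. bilinear_form f"
    by (simp add: bilinear_form_u bilinear_form_add bilinear_form_const_mult)
  moreover have "sos_representation T ?fs"
  proof -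
    \<comment> \<open>Exchanging the \<open>y\<close> indices turns the \<open>a\<close> and
      \<open>b\<close> terms into products of the \<open>u i i\<close>, and the \<open>q\<close>
      terms of each block into the \<open>p\<close> terms of the next, cyclically.\<close>
    have swaps: "u 1 2 * u 2 1 = u 1 1 * u 2 2" "u 3 4 * u 4 3 = u 3 3 * u 4 4"
      "u 1 3 * u 3 1 = u 1 1 * u 3 3" "u 4 2 * u 2 4 = u 2 2 * u 4 4"
      "u 1 4 * u 4 1 = u 1 1 * u 4 4" "u 2 3 * u 3 2 = u 2 2 * u 3 3"
      "u 1 2 * u 4 3 = u 1 3 * u 4 2" "u 2 1 * u 3 4 = u 3 1 * u 2 4"
      "u 1 3 * u 2 4 = u 1 4 * u 2 3" "u 3 1 * u 4 2 = u 4 1 * u 3 2"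
      "u 1 4 * u 3 2 = u 1 2 * u 3 4" "u 4 1 * u 2 3 = u 2 1 * u 4 3"
      by (simp_all add: u_def ac_simps)
    have "(\<Sum>f\<leftarrow>?fs. f\<^sup>2) =
        ((u 1 1 + const a * u 2 2 + const a * u 3 3 + const a * u 4 4)\<^sup>2
          + (const s * u 2 2 + (- const m) * u 3 3 + (- const m) * u 4 4)\<^sup>2
          + (const n * u 3 3 + (- const n) * u 4 4)\<^sup>2)
        + ((?e (u 1 2) (u 2 1) (u 3 4) (u 4 3))\<^sup>2 + (?f (u 2 1) (u 3 4) (u 4 3))\<^sup>2)
        + ((?e (u 1 3) (u 3 1) (u 4 2) (u 2 4))\<^sup>2 + (?f (u 3 1) (u 4 2) (u 2 4))\<^sup>2)
        + ((?e (u 1 4) (u 4 1) (u 2 3) (u 3 2))\<^sup>2 + (?f (u 4 1) (u 2 3) (u 3 2))\<^sup>2)"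
      by (simp only: list.map sum_list.Cons sum_list.Nil add_0_right add.assoc const_uminus)
    also have "\<dots> = T"
      unfolding diagonal_block[OF diag'] const_uminus off_diagonal_block[OF off'] swaps T_expand
      by (rule blocks_sum[OF pq'])
    finally show ?thesis unfolding sos_representation_def by (rule sym)
  qed
  moreover have "length ?fs = 9" by simp
  ultimately show ?thesis by blast
qed

lemma ten_forms_sos: "sos_representation T ten_forms"
  by (simp add: sos_representation_def T_def ten_forms_def sum_four add.assoc)

theorem theorem5p3:
  shows "(\<exists>fs. length fs = 9 \<and> (\<forall>f\<in>set fs. bilinear_form f) \<and> sos_representation T fs)
       \<and> reducible_representation T ten_forms"
proof -
  obtain fs where "length fs = 9" "sos_representation T fs"
    using T_nine_squares by blast
  moreover have "length ten_forms = 10" by (simp add: ten_forms_def)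
  ultimately have "\<not> minimum_length_representation T ten_forms"
    by (auto simp: minimum_length_representation_def intro!: exI[of _ fs])
  then show ?thesis
    using T_nine_squares ten_forms_sos by (simp add: reducible_representation_def)
qed

end
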